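(* Let $\mathbf{z}$ be an infinite word over a finite alphabet such that for some integer $k\ge 2$ we have $b^{(k)}_{\mathbf{z}}(n)=n+1$ for all $n\ge 0$. Then $\mathbf{z}$ is Sturmian.
   Context: For words $u,w$, $\binom{u}{w}$ denotes the number of occurrences of $w$ as a scattered subword of $u$. Two words $u,v$ are $k$-binomially equivalent ($u\sim_k v$) if $\binom{u}{x}=\binom{v}{x}$ for all words $x$ of length at most $k$. For an infinite word $\mathbf{x}$, $b^{(k)}_{\mathbf{x}}(n)$ is the number of $\sim_k$-equivalence classes among the length-$n$ factors of $\mathbf{x}$. An infinite word is Sturmian if it has exactly $n+1$ distinct factors of length $n$ for every $n\ge0$. *)

theory Defs
  imports Main
begin

text \<open>Finite words are lists; an infinite word is a function on \<^typ>\<open>nat\<close>.\<close>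

text \<open>An occurrence of \<open>w\<close> as a scattered subword of \<open>u\<close> is a set of positions of \<open>u\<close> at which
  \<open>w\<close> is read in increasing order.\<close>

definition subword_count :: "'a list \<Rightarrow> 'a list \<Rightarrow> nat" where
  "subword_count u w = card {I. I \<subseteq> {..<length u} \<and> nths u I = w}"

definition binomial_equiv :: "nat \<Rightarrow> ('a list \<times> 'a list) set" where
  "binomial_equiv k =
     {(u, v). \<forall>x. length x \<le> k \<longrightarrow> subword_count u x = subword_count v x}"

definition factors :: "(nat \<Rightarrow> 'a) \<Rightarrow> nat \<Rightarrow> 'a list set" where
  "factors z n = {map z [i..<i + n] | i. True}"

definition binomial_complexity :: "nat \<Rightarrow> (nat \<Rightarrow> 'a) \<Rightarrow> nat \<Rightarrow> nat" where
  "binomial_complexity k z n = card (factors z n // binomial_equiv k)"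

definition sturmian :: "(nat \<Rightarrow> 'a) \<Rightarrow> bool" where
  "sturmian z \<longleftrightarrow> (\<forall>n. card (factors z n) = n + 1)"

end

theory Submission
  imports Defs "HOL-Library.Sublist"
begin

text \<open>
  In a word \<open>u\<close> the pairs of positions of which the first carries the letter \<open>a\<close> are counted both by
  \<open>\<Sum>c. subword_count u [a, c]\<close> and by adding up the numbers of letters \<open>a\<close> in the proper prefixes of
  \<open>u\<close>. Suppose that \<open>u \<noteq> v\<close> are 2-binomially equivalent, that shorter factors of the word are balanced,
  and that \<open>u\<close> has the letter \<open>a\<close> at the first mismatch. Then every prefix of \<open>u\<close> contains at least
  as many \<open>a\<close> as the corresponding prefix of \<open>v\<close>, and one of them contains more, although the sums
  agree. So, as long as all shorter lengths are balanced, binomial equivalence is equality on the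
  factors of length \<open>n\<close>, and there are \<open>n + 1\<close> of them.

  It remains to see that the word is balanced in all lengths. In the least length \<open>m\<close> in which it is
  not, there are factors \<open>awa\<close> and \<open>bwb\<close> with \<open>w\<close> a palindrome. Up to \<open>m\<close> the factor counts grow by
  one, so in every length below \<open>m\<close> exactly one factor is right special, that is, followed by two
  different letters. In length \<open>m - 2\<close> it is \<open>w\<close>, hence in length \<open>m - 1\<close> it is \<open>aw\<close> or \<open>bw\<close>, say
  \<open>aw\<close>. As \<open>w\<close> is a palindrome, \<open>aw\<close> does not begin inside the occurrence of \<open>bwb\<close>. By the pigeonhole
  principle some factor of length \<open>m - 1\<close> recurs within this stretch, where every factor determines
  its successor, so the word is eventually periodic. Then its numbers of factors are bounded, although
  they are at least the binomial complexity \<open>n + 1\<close>.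
\<close>

section \<open>Scattered subwords\<close>

definition occurrences :: "'a list \<Rightarrow> 'a list \<Rightarrow> nat set set" where
  "occurrences u w = {I \<in> Pow {..<length u}. nths u I = w}"

lemma subword_count_eq_card_occurrences: "subword_count u w = card (occurrences u w)"
  by (simp add: subword_count_def occurrences_def)

lemma finite_occurrences: "finite (occurrences u w)"
  by (simp add: occurrences_def)

lemma Pow_lessThan_Suc:
  "Pow {..<Suc n} = image Suc ` Pow {..<n} \<union> (\<lambda>I. insert 0 (Suc ` I)) ` Pow {..<n}"
proof -
  have "Pow (Suc ` {..<n}) = image Suc ` Pow {..<n}"
    by (rule image_Pow_surj[symmetric]) simp
  then show ?thesis
    by (simp add: lessThan_Suc_eq_insert_0 Pow_insert image_image)
qed

lemma occurrences_Cons_Cons: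
  "occurrences (x # u) (c # w) =
     image Suc ` occurrences u (c # w) \<union>
     (if x = c then (\<lambda>I. insert 0 (Suc ` I)) ` occurrences u w else {})"
proof -
  have "{j. Suc j \<in> Suc ` I} = I" "{j. Suc j \<in> insert 0 (Suc ` I)} = I" for I
    by auto
  then have "nths (x # u) (Suc ` I) = nths u I" "nths (x # u) (insert 0 (Suc ` I)) = x # nths u I"
    for I by (simp_all add: nths_Cons)
  then show ?thesis
    by (auto simp: occurrences_def Pow_lessThan_Suc simp del: Pow_iff)
qed

lemma subword_count_Nil_right: "subword_count u [] = 1"
proof -
  have "occurrences u [] = {{}}"
  proof (intro equalityI subsetI)
    fix I assume "I \<in> occurrences u []"
    then have "I \<subseteq> {..<length u}" and "set (nths u I) = {}"
      by (simp_all add: occurrences_def)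
    then have "I = {}"
      unfolding set_nths by blast
    then show "I \<in> {{}}" by simp
  qed (simp add: occurrences_def)
  then show ?thesis
    by (simp add: subword_count_eq_card_occurrences)
qed

lemma subword_count_Nil_Cons: "subword_count [] (c # w) = 0"
  by (simp add: subword_count_def)

lemma subword_count_Cons_Cons:
  "subword_count (x # u) (c # w) =
     subword_count u (c # w) + (if x = c then subword_count u w else 0)"
proof -
  let ?skip = "image Suc" and ?keep = "\<lambda>I. insert 0 (Suc ` I)"
  have inj: "inj ?skip" "inj ?keep"
    by (auto simp: inj_def)
  have disjoint: "?skip ` A \<inter> ?keep ` B = {}" for A B
    by auto
  show ?thesis
  proof (cases "x = c")
    case True
    have "card (?skip ` occurrences u (c # w) \<union> ?keep ` occurrences u w) =
        card (?skip ` occurrences u (c # w)) + card (?keep ` occurrences u w)"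
      by (intro card_Un_disjoint finite_imageI finite_occurrences disjoint)
    with True show ?thesis
      by (simp add: subword_count_eq_card_occurrences occurrences_Cons_Cons
          card_image inj_on_subset[OF inj(1)] inj_on_subset[OF inj(2)])
  next
    case False
    then show ?thesis
      by (simp add: subword_count_eq_card_occurrences occurrences_Cons_Cons
          card_image inj_on_subset[OF inj(1)])
  qed
qed

lemmas subword_count_simps =
  subword_count_Nil_right subword_count_Nil_Cons subword_count_Cons_Cons

lemma subword_count_single: "subword_count u [a] = count_list u a"
  by (induction u) (simp_all add: subword_count_simps)

lemma sum_count_list_take:
  assumes "finite A" "set u \<subseteq> A"
  shows "(\<Sum>s\<le>length u. count_list (take s u) a) =
    count_list u a + (\<Sum>c\<in>A. subword_count u [a, c])"
  using assms(2)
proof (induction u)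
  case Nil
  show ?case by (simp add: subword_count_Nil_Cons)
next
  case (Cons x u)
  let ?e = "if x = a then 1 else 0 :: nat"
  have "(\<Sum>s\<le>length (x # u). count_list (take s (x # u)) a) =
      (\<Sum>s\<le>length u. count_list (take s u) a + ?e)"
    by (simp add: sum.atMost_Suc_shift del: sum.atMost_Suc)
  also have "\<dots> = (\<Sum>s\<le>length u. count_list (take s u) a) + (length u + 1) * ?e"
    by (simp add: sum.distrib)
  also have "\<dots> = (count_list u a + ?e) + ((\<Sum>c\<in>A. subword_count u [a, c]) + length u * ?e)"
    using Cons by simp
  also have "length u = (\<Sum>c\<in>A. subword_count u [c])"
    using sum_count_set[of u A] Cons.prems \<open>finite A\<close> by (simp add: subword_count_single)
  also have "count_list u a + ?e = count_list (x # u) a"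
    by simp
  also have "(\<Sum>c\<in>A. subword_count u [a, c]) + (\<Sum>c\<in>A. subword_count u [c]) * ?e =
      (\<Sum>c\<in>A. subword_count (x # u) [a, c])"
    by (simp add: subword_count_Cons_Cons sum.distrib)
  finally show ?case .
qed

section \<open>Binomial equivalence and balanced words\<close>

lemma equiv_binomial_equiv: "equiv UNIV (binomial_equiv k)"
  by (auto simp: binomial_equiv_def intro!: equivI refl_onI symI transI)

lemma binomial_equivD:
  assumes "(u, v) \<in> binomial_equiv k" "length x \<le> k"
  shows "subword_count u x = subword_count v x"
  using assms by (simp add: binomial_equiv_def)

lemma binomial_equiv_imp_length_eq:
  assumes "(u, v) \<in> binomial_equiv k" "k \<ge> 1"
  shows "length u = length v"
proof -
  have "count_list u c = count_list v c" for c
    using binomial_equivD[OF assms(1), of "[c]"] assms(2) by (simp add: subword_count_single)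
  then show ?thesis
    using sum_count_set[of u "set u \<union> set v"] sum_count_set[of v "set u \<union> set v"] by simp
qed

lemma binomial_equiv_imp_sum_count_list_take_eq:
  assumes "(u, v) \<in> binomial_equiv k" "k \<ge> 2"
  shows "(\<Sum>s\<le>length u. count_list (take s u) a) = (\<Sum>s\<le>length v. count_list (take s v) a)"
proof -
  let ?A = "set u \<union> set v"
  have "subword_count u [a] = subword_count v [a]"
    "subword_count u [a, c] = subword_count v [a, c]" for c
    using assms(2) by (auto intro: binomial_equivD[OF assms(1)])
  then show ?thesis
    using sum_count_list_take[of ?A u a] sum_count_list_take[of ?A v a]
    by (simp add: subword_count_single)
qed

definition proper_factors_balanced :: "'a list \<Rightarrow> 'a list \<Rightarrow> bool" where
  "proper_factors_balanced u v \<longleftrightarrow>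
    (\<forall>x y a. sublist x u \<and> sublist y v \<and> length x = length y \<and> length x < length u \<longrightarrow>
      count_list x a \<le> count_list y a + 1 \<and> count_list y a \<le> count_list x a + 1)"

lemma proper_factors_balancedD:
  assumes "proper_factors_balanced u v" "sublist x u" "sublist y v"
    and "length x = length y" "length x < length u"
  shows "count_list x a \<le> count_list y a + 1" and "count_list y a \<le> count_list x a + 1"
  using assms by (auto simp: proper_factors_balanced_def)

lemma binomial_equiv_imp_eq_if_balanced:
  assumes equiv: "(u, v) \<in> binomial_equiv k" "k \<ge> 2"
    and balanced: "proper_factors_balanced u v"
  shows "u = v"
proof (rule ccontr)
  assume "u \<noteq> v"
  moreover have len: "length u = length v"
    using binomial_equiv_imp_length_eq[OF equiv(1)] equiv(2) by simp
  ultimately obtain p a u' b v' where "a \<noteq> b"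
    and u: "u = p @ [a] @ u'" and v: "v = p @ [b] @ v'"
    using same_length_different by metis
  have "count_list (take s v) a \<le> count_list (take s u) a" for s
  proof (cases "s \<le> length p")
    case True
    then show ?thesis by (simp add: u v)
  next
    case False
    then obtain l where s: "s = length p + Suc l"
      by (metis add_Suc_right less_imp_Suc_add not_le)
    have "count_list (take l v') a \<le> count_list (take l u') a + 1"
    proof (rule proper_factors_balancedD(2)[OF balanced])
      show "sublist (take l u') u"
        unfolding u by (meson sublist_append_leftI sublist_order.order_trans sublist_take)
      show "sublist (take l v') v"
        unfolding v by (meson sublist_append_leftI sublist_order.order_trans sublist_take)
      show "length (take l u') = length (take l v')" "length (take l u') < length u"
        using len by (simp_all add: u v)
    qed
    with \<open>a \<noteq> b\<close> show ?thesis by (simp add: u v s)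
  qed
  moreover have "count_list (take (Suc (length p)) v) a < count_list (take (Suc (length p)) u) a"
    using \<open>a \<noteq> b\<close> by (simp add: u v)
  moreover have "Suc (length p) \<le> length u"
    by (simp add: u)
  ultimately have "(\<Sum>s\<le>length u. count_list (take s v) a) < (\<Sum>s\<le>length u. count_list (take s u) a)"
    by (intro sum_strict_mono_ex1) auto
  with binomial_equiv_imp_sum_count_list_take_eq[OF equiv, of a] len show False by simp
qed

lemma binary_word_eqI:
  assumes "set u \<subseteq> {a, b}" "set v \<subseteq> {a, b}" "length u = length v"
    and counts: "\<And>s. s \<le> length u \<Longrightarrow> count_list (take s u) a = count_list (take s v) a"
  shows "u = v"
proof (rule ccontr)
  assume "u \<noteq> v"
  with assms(3) obtain p x u' y v' where "x \<noteq> y"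
    and u: "u = p @ [x] @ u'" and v: "v = p @ [y] @ v'"
    using same_length_different by metis
  have "x \<in> {a, b}" "y \<in> {a, b}"
    using assms(1,2) by (simp_all add: u v)
  moreover have "x = a \<longleftrightarrow> y = a"
    using counts[of "Suc (length p)"] by (auto simp: u v split: if_splits)
  ultimately show False
    using \<open>x \<noteq> y\<close> by blast
qed

lemma count_list_take_drop_if_minimal_unbalanced:
  assumes len: "length u = length v"
    and unbalanced: "count_list u a \<ge> count_list v a + 2"
    and balanced: "proper_factors_balanced u v"
    and s: "0 < s" "s < length u"
  shows "count_list (take s u) a = count_list (take s v) a + 1"
    and "count_list (drop s u) a = count_list (drop s v) a + 1"
proof -
  have split: "count_list x a = count_list (take s x) a + count_list (drop s x) a" for x
    by (metis append_take_drop_id count_list_append)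
  have "count_list (take s u) a \<le> count_list (take s v) a + 1"
    "count_list (drop s u) a \<le> count_list (drop s v) a + 1"
    using len s by (intro proper_factors_balancedD(1)[OF balanced]; simp)+
  with unbalanced show "count_list (take s u) a = count_list (take s v) a + 1"
    "count_list (drop s u) a = count_list (drop s v) a + 1"
    using split[of u] split[of v] by linarith+
qed

lemma palindrome_if_minimal_unbalanced:
  assumes binary: "set u \<subseteq> {a, b}"
    and len: "length u = length v"
    and unbalanced: "count_list u a \<ge> count_list v a + 2"
    and balanced: "proper_factors_balanced u v"
  shows "rev u = u"
proof (rule binary_word_eqI)
  show "set (rev u) \<subseteq> {a, b}" "set u \<subseteq> {a, b}" "length (rev u) = length u"
    using binary by simp_all
  fix s assume "s \<le> length (rev u)"
  then consider "s = 0" | "s = length u" | "0 < s" "s < length u"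
    by fastforce
  then show "count_list (take s (rev u)) a = count_list (take s u) a"
  proof cases
    case 3
    let ?r = "length u - s"
    note counts = count_list_take_drop_if_minimal_unbalanced[OF len unbalanced balanced]
    have "count_list (take s u) a \<le> count_list (drop ?r v) a + 1"
      "count_list (drop ?r u) a \<le> count_list (take s v) a + 1"
      using len 3 by (intro proper_factors_balancedD(1)[OF balanced]; simp)+
    moreover have "count_list (take s u) a = count_list (take s v) a + 1"
      "count_list (drop ?r u) a = count_list (drop ?r v) a + 1"
      using 3 counts(1)[of s] counts(2)[of ?r] by simp_all
    ultimately show ?thesis by (simp add: take_rev)
  qed simp_all
qed

lemma minimal_unbalanced_pairE:
  assumes binary: "set u \<subseteq> {a, b}" "set v \<subseteq> {a, b}"
    and len: "length u = length v"
    and unbalanced: "count_list u a \<ge> count_list v a + 2"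
    and balanced: "proper_factors_balanced u v"
  obtains w where "u = a # w @ [a]" "v = b # w @ [b]" "rev w = w"
proof -
  note counts = count_list_take_drop_if_minimal_unbalanced[OF len unbalanced balanced]
  have two_le: "2 \<le> length u"
    using unbalanced count_le_length[of u a] by linarith
  have decompose: "\<exists>x y x'. w = x # y @ [x']" if "2 \<le> length w" for w :: "'a list"
    using that by (cases w; cases "tl w" rule: rev_cases) auto
  obtain x w x' y w' y' where u: "u = x # w @ [x']" and v: "v = y # w' @ [y']"
    using decompose[of u] decompose[of v] two_le len by auto
  have len': "length w = length w'"
    using len by (simp add: u v)
  have "x = a" "y \<noteq> a"
    using counts(1)[of 1] by (simp_all add: u v split: if_splits)
  moreover have "x' = a" "y' \<noteq> a"
    using counts(2)[of "Suc (length w)"] by (simp_all add: u v len' split: if_splits)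
  moreover have "w = w'"
  proof (rule binary_word_eqI)
    show "set w \<subseteq> {a, b}" "set w' \<subseteq> {a, b}"
      using binary by (auto simp: u v)
    show "count_list (take s w) a = count_list (take s w') a" if "s \<le> length w" for s
      using counts(1)[of "Suc s"] that \<open>x = a\<close> \<open>y \<noteq> a\<close> len' by (simp add: u v)
  qed (fact len')
  ultimately have shape: "u = a # w @ [a]" "v = b # w @ [b]"
    using binary by (auto simp: u v)
  moreover have "rev w = w"
    using palindrome_if_minimal_unbalanced[OF binary(1) len unbalanced balanced] shape(1) by simp
  ultimately show ?thesis by (rule that)
qed

section \<open>Factors of infinite words\<close>

definition factor_at :: "(nat \<Rightarrow> 'a) \<Rightarrow> nat \<Rightarrow> nat \<Rightarrow> 'a list" where
  "factor_at z i n = map z [i..<i + n]"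

lemma factors_eq_range: "factors z n = range (\<lambda>i. factor_at z i n)"
  by (auto simp: factors_def factor_at_def)

lemma length_factor_at [simp]: "length (factor_at z i n) = n"
  by (simp add: factor_at_def)

lemma nth_factor_at: "s < n \<Longrightarrow> factor_at z i n ! s = z (i + s)"
  by (simp add: factor_at_def)

lemma factor_at_eq_iff: "factor_at z i n = factor_at z j n \<longleftrightarrow> (\<forall>s<n. z (i + s) = z (j + s))"
  by (auto simp: list_eq_iff_nth_eq nth_factor_at)

lemma factor_at_add: "factor_at z i (m + n) = factor_at z i m @ factor_at z (i + m) n"
  by (simp add: factor_at_def upt_add_eq_append[of i "i + m"] add.assoc[symmetric] flip: map_append)

lemma factor_at_Suc: "factor_at z i (Suc n) = factor_at z i n @ [z (i + n)]"
  by (simp add: factor_at_def)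

lemma length_factors: "u \<in> factors z n \<Longrightarrow> length u = n"
  by (auto simp: factors_eq_range)

lemma set_factors: "u \<in> factors z n \<Longrightarrow> set u \<subseteq> range z"
  by (auto simp: factors_def)

lemma finite_factors:
  assumes "finite (range z)"
  shows "finite (factors z n)"
proof (rule finite_subset)
  show "factors z n \<subseteq> {u. set u \<subseteq> range z \<and> length u = n}"
    using length_factors set_factors by fast
  show "finite {u. set u \<subseteq> range z \<and> length u = n}"
    using assms by (rule finite_lists_length_eq)
qed

lemma card_factors_Suc_0: "card (factors z (Suc 0)) = card (range z)"
proof -
  have "factors z (Suc 0) = (\<lambda>c. [c]) ` range z"
    by (auto simp: factors_def)
  then show ?thesis
    by (simp add: card_image inj_on_def)
qed

lemma sublist_in_factors:
  assumes "u \<in> factors z n" "sublist x u"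
  shows "x \<in> factors z (length x)"
proof -
  obtain p s where u: "u = p @ x @ s"
    using assms(2) by (auto simp: sublist_def)
  obtain i where "u = factor_at z i (length p + (length x + length s))"
    using assms(1) length_factors[OF assms(1)] by (auto simp: factors_eq_range u)
  then have "x = factor_at z (i + length p) (length x)"
    by (simp add: u factor_at_add)
  then show ?thesis
    by (metis factors_eq_range rangeI)
qed

definition eventually_periodic :: "(nat \<Rightarrow> 'a) \<Rightarrow> bool" where
  "eventually_periodic z \<longleftrightarrow> (\<exists>p d. d > 0 \<and> (\<forall>i\<ge>p. z (i + d) = z i))"

lemma card_factors_bounded_if_eventually_periodic:
  assumes "eventually_periodic z"
  obtains B where "\<And>n. card (factors z n) \<le> B"
proof -
  obtain p d where "d > 0" and period: "\<And>i. i \<ge> p \<Longrightarrow> z (i + d) = z i"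
    using assms by (auto simp: eventually_periodic_def)
  have "card (factors z n) \<le> p + d" for n
  proof -
    have "factor_at z i n \<in> (\<lambda>j. factor_at z j n) ` {..<p + d}" for i
    proof (induction i rule: less_induct)
      case (less i)
      show ?case
      proof (cases "i < p + d")
        case False
        then have "z (i + s) = z (i - d + s)" for s
          using period[of "i - d + s"] by simp
        then have "factor_at z i n = factor_at z (i - d) n"
          by (simp add: factor_at_eq_iff)
        with less[of "i - d"] \<open>d > 0\<close> False show ?thesis by simp
      qed simp
    qed
    then have "factors z n \<subseteq> (\<lambda>j. factor_at z j n) ` {..<p + d}"
      by (auto simp: factors_eq_range)
    from surj_card_le[OF _ this] show ?thesis by simp
  qed
  then show ?thesis by (rule that)
qed

section \<open>Right special factors\<close>

definition right_extensions :: "(nat \<Rightarrow> 'a) \<Rightarrow> 'a list \<Rightarrow> 'a set" where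
  "right_extensions z u = {c. u @ [c] \<in> factors z (Suc (length u))}"

definition right_special :: "(nat \<Rightarrow> 'a) \<Rightarrow> 'a list \<Rightarrow> bool" where
  "right_special z u \<longleftrightarrow> (\<exists>c\<in>right_extensions z u. \<exists>d\<in>right_extensions z u. c \<noteq> d)"

lemma right_specialI:
  assumes "u @ [c] \<in> factors z m" "u @ [d] \<in> factors z n" "c \<noteq> d"
  shows "right_special z u"
  using assms length_factors[OF assms(1)] length_factors[OF assms(2)]
  by (auto simp: right_special_def right_extensions_def)

lemma right_special_suffix:
  assumes "right_special z (p @ u)"
  shows "right_special z u"
proof -
  obtain c d where "p @ u @ [c] \<in> factors z (Suc (length (p @ u)))"
    "p @ u @ [d] \<in> factors z (Suc (length (p @ u)))" "c \<noteq> d"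
    using assms by (auto simp: right_special_def right_extensions_def)
  then show ?thesis
    by (meson right_specialI sublist_append_leftI sublist_in_factors)
qed

lemma right_special_in_factors:
  assumes "right_special z u"
  shows "u \<in> factors z (length u)"
  using assms sublist_in_factors[OF _ sublist_append_rightI]
  by (auto simp: right_special_def right_extensions_def)

lemma right_extension_factor_at: "z (i + n) \<in> right_extensions z (factor_at z i n)"
  by (simp add: right_extensions_def factors_eq_range flip: factor_at_Suc)

lemma right_extensions_nonempty: "u \<in> factors z n \<Longrightarrow> right_extensions z u \<noteq> {}"
  using right_extension_factor_at by (fastforce simp: factors_eq_range)

lemma finite_right_extensions:
  assumes "finite (range z)"
  shows "finite (right_extensions z u)"
proof (rule finite_subset[OF _ assms])
  show "right_extensions z u \<subseteq> range z"
    using set_factors by (fastforce simp: right_extensions_def)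
qed

lemma card_factors_Suc:
  assumes "finite (range z)"
  shows "card (factors z (Suc n)) = (\<Sum>u\<in>factors z n. card (right_extensions z u))"
proof -
  have "factors z (Suc n) = (\<lambda>(u, c). u @ [c]) ` (SIGMA u:factors z n. right_extensions z u)"
  proof (intro equalityI subsetI)
    fix v assume "v \<in> factors z (Suc n)"
    then obtain i where v: "v = factor_at z i n @ [z (i + n)]"
      by (auto simp: factors_eq_range factor_at_Suc)
    have "(factor_at z i n, z (i + n)) \<in> (SIGMA u:factors z n. right_extensions z u)"
      using right_extension_factor_at by (auto simp: factors_eq_range)
    then show "v \<in> (\<lambda>(u, c). u @ [c]) ` (SIGMA u:factors z n. right_extensions z u)"
      unfolding v by force
  qed (auto simp: right_extensions_def length_factors)
  moreover have "inj_on (\<lambda>(u, c). u @ [c]) S" for S :: "('a list \<times> 'a) set"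
    by (auto simp: inj_on_def)
  ultimately have "card (factors z (Suc n)) = card (SIGMA u:factors z n. right_extensions z u)"
    by (simp add: card_image)
  then show ?thesis
    using assms by (simp add: finite_factors finite_right_extensions)
qed

lemma ex1_right_special:
  assumes finite_alphabet: "finite (range z)"
    and card: "card (factors z (Suc n)) = card (factors z n) + 1"
  shows "\<exists>!u. length u = n \<and> right_special z u"
proof -
  let ?excess = "\<lambda>u. card (right_extensions z u) - 1"
  have right_special_iff: "right_special z u \<longleftrightarrow> ?excess u \<noteq> 0" for u
    using card_le_Suc0_iff_eq[OF finite_right_extensions[OF finite_alphabet, of u]]
    by (auto simp: right_special_def)
  have "card (right_extensions z u) \<ge> 1" if "u \<in> factors z n" for u
    using right_extensions_nonempty[OF that] finite_right_extensions[OF finite_alphabet]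
    by (simp add: Suc_le_eq card_gt_0_iff)
  then have "(\<Sum>u\<in>factors z n. ?excess u) =
      (\<Sum>u\<in>factors z n. card (right_extensions z u)) - card (factors z n)"
    by (simp add: sum_subtractf_nat)
  also have "\<dots> = 1"
    using card by (simp add: card_factors_Suc[OF finite_alphabet])
  finally have "\<exists>u\<in>factors z n. ?excess u = 1 \<and> (\<forall>v\<in>factors z n. u \<noteq> v \<longrightarrow> ?excess v = 0)"
    by (simp only: sum_eq_1_iff[OF finite_factors[OF finite_alphabet]])
  then obtain u where u: "u \<in> factors z n" "right_special z u"
    and unique: "\<And>v. v \<in> factors z n \<Longrightarrow> right_special z v \<Longrightarrow> v = u"
    unfolding right_special_iff by (metis zero_neq_one)
  show ?thesis
  proof (rule ex1I)
    show "length u = n \<and> right_special z u"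
      using u length_factors by blast
    show "v = u" if "length v = n \<and> right_special z v" for v
      using that unique right_special_in_factors by blast
  qed
qed

lemma factor_at_Suc_eq_if_not_right_special:
  assumes "factor_at z i n = factor_at z j n" "\<not> right_special z (factor_at z i n)"
  shows "factor_at z i (Suc n) = factor_at z j (Suc n)"
  using assms right_extension_factor_at[of z i n] right_extension_factor_at[of z j n]
  by (auto simp: factor_at_Suc right_special_def)

lemma factors_repeat_if_not_right_special:
  assumes d: "d > 0" "factor_at z p n = factor_at z (p + d) n"
    and not_special: "\<And>t. t < d \<Longrightarrow> \<not> right_special z (factor_at z (p + t) n)"
  shows "factor_at z (p + t) n = factor_at z (p + t + d) n \<and>
    \<not> right_special z (factor_at z (p + t) n)"
proof (induction t rule: less_induct)
  case (less t)
  have "factor_at z (p + t) n = factor_at z (p + t + d) n"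
  proof (cases t)
    case 0
    with d(2) show ?thesis by simp
  next
    case (Suc s)
    with less have "factor_at z (p + s) n = factor_at z (p + s + d) n"
      "\<not> right_special z (factor_at z (p + s) n)"
      by blast+
    then have "factor_at z (p + s) (1 + n) = factor_at z (p + s + d) (1 + n)"
      using factor_at_Suc_eq_if_not_right_special by (metis plus_1_eq_Suc)
    then show ?thesis
      unfolding factor_at_add by (simp add: Suc)
  qed
  moreover have "\<not> right_special z (factor_at z (p + t) n)"
  proof (cases "t < d")
    case False
    then have "p + (t - d) + d = p + t" "t - d < t"
      using d(1) by auto
    with less[of "t - d"] show ?thesis by metis
  qed (fact not_special)
  ultimately show ?case ..
qed

lemma eventually_periodic_if_factors_repeat:
  assumes d: "d > 0" "factor_at z p n = factor_at z (p + d) n"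
    and not_special: "\<And>t. t < d \<Longrightarrow> \<not> right_special z (factor_at z (p + t) n)"
  shows "eventually_periodic z"
proof -
  have "z (i + d) = z i" if "p \<le> i" for i
  proof -
    have "factor_at z i n = factor_at z (i + d) n" "\<not> right_special z (factor_at z i n)"
      using factors_repeat_if_not_right_special[OF assms, of "i - p"] that by auto
    then have "factor_at z i (Suc n) = factor_at z (i + d) (Suc n)"
      by (rule factor_at_Suc_eq_if_not_right_special)
    then show ?thesis
      by (auto simp: factor_at_eq_iff dest: spec[of _ 0])
  qed
  with d(1) show ?thesis
    by (auto simp: eventually_periodic_def)
qed

lemma eventually_periodic_if_no_right_special_window:
  assumes finite_alphabet: "finite (range z)"
    and card: "card {u \<in> factors z n. \<not> right_special z u} \<le> N"
    and not_special: "\<And>t. t \<le> N \<Longrightarrow> \<not> right_special z (factor_at z (j + t) n)"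
  shows "eventually_periodic z"
proof -
  let ?S = "{u \<in> factors z n. \<not> right_special z u}"
  have "(\<lambda>t. factor_at z (j + t) n) ` {..N} \<subseteq> ?S"
    using not_special by (auto simp: factors_eq_range)
  then have "card ((\<lambda>t. factor_at z (j + t) n) ` {..N}) \<le> card ?S"
    by (rule card_mono[rotated]) (simp add: finite_factors[OF finite_alphabet])
  also have "\<dots> < card {..N}"
    using card by simp
  finally have "\<not> inj_on (\<lambda>t. factor_at z (j + t) n) {..N}"
    by (rule pigeonhole)
  then obtain s t where "s < t" "t \<le> N" and eq: "factor_at z (j + s) n = factor_at z (j + t) n"
    unfolding inj_on_def by (metis atMost_iff linorder_neqE_nat)
  show ?thesis
  proof (rule eventually_periodic_if_factors_repeat)
    show "t - s > 0" "factor_at z (j + s) n = factor_at z (j + s + (t - s)) n"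
      using \<open>s < t\<close> eq by simp_all
    show "\<not> right_special z (factor_at z (j + s + r) n)" if "r < t - s" for r
      using not_special[of "s + r"] that \<open>t \<le> N\<close> by (simp add: add.assoc)
  qed
qed

section \<open>Balanced infinite words\<close>

definition balanced :: "'a list set \<Rightarrow> bool" where
  "balanced U \<longleftrightarrow> (\<forall>u\<in>U. \<forall>v\<in>U. \<forall>a. count_list u a \<le> count_list v a + 1)"

lemma proper_factors_balanced_if_balanced_factors:
  assumes "\<And>l. l < n \<Longrightarrow> balanced (factors z l)" "u \<in> factors z n" "v \<in> factors z n"
  shows "proper_factors_balanced u v"
  unfolding proper_factors_balanced_def
proof (intro allI impI, elim conjE)
  fix x y a
  assume "sublist x u" "sublist y v" "length x = length y" "length x < length u"
  then have "x \<in> factors z (length x)" "y \<in> factors z (length x)" "balanced (factors z (length x))"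
    using assms(1) length_factors[OF assms(2)]
      sublist_in_factors[OF assms(2)] sublist_in_factors[OF assms(3)] by metis+
  then show "count_list x a \<le> count_list y a + 1 \<and> count_list y a \<le> count_list x a + 1"
    by (simp add: balanced_def)
qed

lemma minimal_unbalanced_factorsE:
  assumes "card (range z) = 2"
    and balanced: "\<And>l. l < m \<Longrightarrow> balanced (factors z l)"
    and unbalanced: "\<not> balanced (factors z m)"
  obtains a b w where "range z = {a, b}" "a \<noteq> b" "rev w = w"
    "a # w @ [a] \<in> factors z m" "b # w @ [b] \<in> factors z m"
proof -
  obtain u v a where u: "u \<in> factors z m" and v: "v \<in> factors z m"
    and "\<not> count_list u a \<le> count_list v a + 1"
    using unbalanced by (auto simp: balanced_def)
  then have count: "count_list u a \<ge> count_list v a + 2"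
    by simp
  have "a \<in> set u"
    using count count_notin[of a u] by fastforce
  then have "a \<in> range z"
    using set_factors[OF u] by blast
  with assms(1) obtain b where ab: "range z = {a, b}" "a \<noteq> b"
    unfolding card_2_iff by (metis insertE insert_commute singletonD)
  have len: "length u = m" "length v = m"
    using u v by (simp_all add: length_factors)
  obtain w where "u = a # w @ [a]" "v = b # w @ [b]" "rev w = w"
  proof (rule minimal_unbalanced_pairE)
    show "set u \<subseteq> {a, b}" "set v \<subseteq> {a, b}"
      using set_factors u v ab(1) by metis+
    show "proper_factors_balanced u v"
      using balanced u v by (rule proper_factors_balanced_if_balanced_factors)
  qed (use len count in simp_all)
  with ab u v that show ?thesis by blast
qed

lemma factor_at_neq_near_palindrome:
  assumes "c \<noteq> d" "rev w = w" "t \<le> Suc (length w)"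
    and dwd: "factor_at z j (Suc (Suc (length w))) = d # w @ [d]"
  shows "factor_at z (j + t) (Suc (length w)) \<noteq> c # w"
proof
  define n where "n = Suc (length w)"
  assume "factor_at z (j + t) (Suc (length w)) = c # w"
  then have cw_nth: "z (j + t + s) = (c # w) ! s" if "s < n" for s
    using that by (metis n_def nth_factor_at)
  have dwd_nth: "z (j + s) = (d # w @ [d]) ! s" if "s \<le> n" for s
    using that dwd by (metis le_imp_less_Suc n_def nth_factor_at)
  have at_t: "z (j + t) = c"
    using cw_nth[of 0] by (simp add: n_def)
  have "z j = d" "z (j + n) = d"
    using dwd_nth[of 0] dwd_nth[of n] by (simp_all add: n_def nth_append)
  with at_t \<open>c \<noteq> d\<close> have "t \<noteq> 0" "t \<noteq> n"
    by (metis add_0_right)+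
  with assms(3) have t: "0 < t" "t < n"
    by (simp_all add: n_def)
  then have "c = w ! (t - 1)"
    using at_t dwd_nth[of t] by (auto simp: n_def nth_append)
  also have "\<dots> = rev w ! (t - 1)"
    by (simp only: \<open>rev w = w\<close>)
  also have "\<dots> = w ! (n - t - 1)"
    using t by (simp add: rev_nth n_def)
  also have "\<dots> = z (j + n)"
    using cw_nth[of "n - t"] t by simp
  finally show False
    using \<open>z (j + n) = d\<close> \<open>c \<noteq> d\<close> by simp
qed

lemma eventually_periodic_if_unique_right_special:
  assumes finite_alphabet: "finite (range z)" and "c \<noteq> d" "rev w = w"
    and special: "right_special z (c # w)"
    and unique: "\<And>u. length u = Suc (length w) \<Longrightarrow> right_special z u \<Longrightarrow> u = c # w"
    and card: "card (factors z (Suc (length w))) \<le> length w + 2"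
    and dwd: "d # w @ [d] \<in> factors z m"
  shows "eventually_periodic z"
proof -
  define n where "n = Suc (length w)"
  obtain j where j: "factor_at z j (Suc n) = d # w @ [d]"
    using dwd length_factors[OF dwd] by (auto simp: factors_eq_range n_def)
  show ?thesis
  proof (rule eventually_periodic_if_no_right_special_window[OF finite_alphabet])
    have "c # w \<in> factors z n"
      using right_special_in_factors[OF special] by (simp add: n_def)
    then have "card (factors z n - {c # w}) \<le> n"
      using card by (simp add: n_def)
    moreover have "card {u \<in> factors z n. \<not> right_special z u} \<le> card (factors z n - {c # w})"
      using special finite_factors[OF finite_alphabet] by (intro card_mono) auto
    ultimately show "card {u \<in> factors z n. \<not> right_special z u} \<le> n"
      by simp
    show "\<not> right_special z (factor_at z (j + t) n)" if "t \<le> n" for t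
    proof
      assume "right_special z (factor_at z (j + t) n)"
      then have "factor_at z (j + t) n = c # w"
        by (intro unique) (simp_all add: n_def)
      with factor_at_neq_near_palindrome[OF \<open>c \<noteq> d\<close> \<open>rev w = w\<close>] that j show False
        by (simp add: n_def)
    qed
  qed
qed

lemma eventually_periodic_if_unbalanced_palindromes:
  assumes binary: "range z = {a, b}" "a \<noteq> b" and "rev w = w"
    and awa: "a # w @ [a] \<in> factors z m" and bwb: "b # w @ [b] \<in> factors z m"
    and card: "\<And>l. l \<le> m \<Longrightarrow> card (factors z l) = l + 1"
  shows "eventually_periodic z"
proof -
  have m_eq: "m = Suc (Suc (length w))"
    using length_factors[OF awa] by simp
  have finite_alphabet: "finite (range z)"
    using binary(1) by simp
  have ex1: "\<exists>!u. length u = l \<and> right_special z u" if "l < m" for l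
    using ex1_right_special[OF finite_alphabet, of l] card[of l] card[of "Suc l"] that by simp
  have "sublist (w @ [a]) (a # w @ [a])" "sublist (w @ [b]) (b # w @ [b])"
    by (metis append_Cons append_Nil sublist_append_leftI)+
  with awa bwb binary(2) have w_special: "right_special z w"
    by (meson right_specialI sublist_in_factors)
  obtain c w' where "right_special z (c # w')" "length w' = length w"
    using ex1[of "Suc (length w)"] m_eq by (auto simp: length_Suc_conv)
  moreover from this have "w' = w"
    using ex1[of "length w"] m_eq w_special right_special_suffix[of z "[c]" w'] by auto
  ultimately have cw_special: "right_special z (c # w)"
    by simp
  have "c \<in> {a, b}"
    using set_factors[OF right_special_in_factors[OF cw_special]] binary(1) by simp
  then obtain d where "c \<noteq> d" and dwd: "d # w @ [d] \<in> factors z m"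
    using awa bwb binary(2) by metis
  show ?thesis
    using finite_alphabet \<open>c \<noteq> d\<close> \<open>rev w = w\<close> cw_special
  proof (rule eventually_periodic_if_unique_right_special)
    show "u = c # w" if "length u = Suc (length w)" "right_special z u" for u
      using ex1[of "Suc (length w)"] m_eq that cw_special by auto
    show "card (factors z (Suc (length w))) \<le> length w + 2"
      using card[of "Suc (length w)"] m_eq by simp
  qed (fact dwd)
qed

lemma balanced_factors_if_card_factors:
  assumes "card (range z) = 2" "\<not> eventually_periodic z"
    and "\<And>l. l < m \<Longrightarrow> balanced (factors z l)"
    and "\<And>l. l \<le> m \<Longrightarrow> card (factors z l) = l + 1"
  shows "balanced (factors z m)"
proof (rule ccontr)
  assume "\<not> balanced (factors z m)"
  with assms(1,3) obtain a b w where "range z = {a, b}" "a \<noteq> b" "rev w = w"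
    "a # w @ [a] \<in> factors z m" "b # w @ [b] \<in> factors z m"
    by (rule minimal_unbalanced_factorsE)
  then have "eventually_periodic z"
    using assms(4) by (rule eventually_periodic_if_unbalanced_palindromes)
  with assms(2) show False by contradiction
qed

section \<open>Binomial complexity\<close>

lemma binomial_complexity_eq_card_image:
  "binomial_complexity k z n = card ((\<lambda>u. binomial_equiv k `` {u}) ` factors z n)"
  by (simp add: binomial_complexity_def quotient_def UNION_singleton_eq_range)

lemma binomial_complexity_le_card_factors:
  assumes "finite (range z)"
  shows "binomial_complexity k z n \<le> card (factors z n)"
  unfolding binomial_complexity_eq_card_image by (intro card_image_le finite_factors assms)

lemma binomial_complexity_eq_card_factors:
  assumes "\<And>l. l < n \<Longrightarrow> balanced (factors z l)" "k \<ge> 2"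
  shows "binomial_complexity k z n = card (factors z n)"
  unfolding binomial_complexity_eq_card_image
proof (intro card_image inj_onI)
  fix u v assume u: "u \<in> factors z n" and v: "v \<in> factors z n"
    and "binomial_equiv k `` {u} = binomial_equiv k `` {v}"
  then have "(u, v) \<in> binomial_equiv k"
    by (simp add: eq_equiv_class_iff[OF equiv_binomial_equiv])
  then show "u = v"
    using assms(2) proper_factors_balanced_if_balanced_factors[OF assms(1) u v]
    by (rule binomial_equiv_imp_eq_if_balanced)
qed

theorem theorem2p11:
  fixes z :: "nat \<Rightarrow> 'a::finite" and k :: nat
  assumes "k \<ge> 2"
    and "\<And>n. binomial_complexity k z n = n + 1"
  shows "sturmian z"
proof -
  have card_factors: "card (factors z n) = n + 1" if "\<And>l. l < n \<Longrightarrow> balanced (factors z l)" for n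
    using binomial_complexity_eq_card_factors[of n z k] that assms by simp
  have "balanced (factors z 0)"
    by (simp add: balanced_def factors_def)
  with card_factors[of 1] have two_letters: "card (range z) = 2"
    by (simp add: card_factors_Suc_0)
  have "n + 1 \<le> card (factors z n)" for n
    using binomial_complexity_le_card_factors[of z k n] assms(2) by simp
  then have aperiodic: "\<not> eventually_periodic z"
    by (metis card_factors_bounded_if_eventually_periodic not_less_eq_eq Suc_eq_plus1)
  have "balanced (factors z n)" for n
  proof (induction n rule: less_induct)
    case (less m)
    show ?case
      using two_letters aperiodic less
    proof (rule balanced_factors_if_card_factors)
      show "card (factors z l) = l + 1" if "l \<le> m" for l
        using less that by (intro card_factors) simp
    qed
  qed
  with card_factors show ?thesis
    by (simp add: sturmian_def)
qed

end
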